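(* If $G$ is an optimal digraph, then $\beta_G \leq \alpha_G$. Furthermore, either $\alpha_G = \beta_G$ or $\alpha_G = \beta_G + 1$.
   Context: Digraphs are finite, loopless, with at most one edge $uv$ per ordered pair. A digraph is $2$-free if no distinct $u,v$ have both $uv,vu$ as edges. A circular interval digraph is a digraph together with a fixed arrangement of its vertices in a circle such that for all distinct $u,v,w$ in clockwise order with $uw\in E(G)$, also $uv,vw\in E(G)$. For distinct $u,v$, $d(u,v) = 1 + |\{w: u,w,v \text{ distinct, in clockwise order}\}|$; this is the length of the ordered pair $uv$. A non-edge is an ordered pair $(u,v)$ of distinct vertices with neither $uv$ nor $vu$ an edge; its length is $d(u,v)$. $\alpha_G$ is the minimum length of a non-edge ($\infty$ if none) and $\beta_G$ the maximum length of an edge ($0$ if none). $\xi(G)$ is the number of pairs $(uv,(w,x))$ with $uv\in E(G)$, $(w,x)$ a non-edge, $d(u,v)>d(w,x)$. $\tilde P_3(G)$ is the number of triples $(a,b,c)$ of distinct vertices with $ab,bc\in E(G)$ and $ac,ca\notin E(G)$. For fixed $n\ge 4$, $G$ is optimal if it is a $2$-free circular interval digraph on $n$ vertices maximizing $\tilde P_3$ among all such digraphs and, subject to this, minimizing $\xi(G)$. *)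

theory Defs
  imports Main "HOL-Library.Extended_Nat"
begin

text \<open>Vertices of a digraph on n vertices are 0,...,n-1, arranged clockwise in this order
around the circle. A digraph is a set of ordered pairs (edges).\<close>

definition digraph :: "nat \<Rightarrow> (nat \<times> nat) set \<Rightarrow> bool" where
  "digraph n E \<longleftrightarrow> E \<subseteq> {0..<n} \<times> {0..<n} \<and> (\<forall>u. (u, u) \<notin> E)"

definition two_free :: "(nat \<times> nat) set \<Rightarrow> bool" where
  "two_free E \<longleftrightarrow> (\<forall>u v. u \<noteq> v \<longrightarrow> \<not> ((u, v) \<in> E \<and> (v, u) \<in> E))"

text \<open>Clockwise distance from u to v: d(u,v) = 1 + number of vertices strictly between.\<close>
definition cdist :: "nat \<Rightarrow> nat \<Rightarrow> nat \<Rightarrow> nat" where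
  "cdist n u v = (v + n - u) mod n"

definition clockwise :: "nat \<Rightarrow> nat \<Rightarrow> nat \<Rightarrow> nat \<Rightarrow> bool" where
  "clockwise n u v w \<longleftrightarrow> u < n \<and> v < n \<and> w < n \<and> u \<noteq> v \<and> v \<noteq> w \<and> u \<noteq> w
     \<and> cdist n u v < cdist n u w"

definition circ_interval :: "nat \<Rightarrow> (nat \<times> nat) set \<Rightarrow> bool" where
  "circ_interval n E \<longleftrightarrow> digraph n E \<and>
     (\<forall>u v w. clockwise n u v w \<and> (u, w) \<in> E \<longrightarrow> (u, v) \<in> E \<and> (v, w) \<in> E)"

definition nonedge :: "nat \<Rightarrow> (nat \<times> nat) set \<Rightarrow> nat \<Rightarrow> nat \<Rightarrow> bool" where
  "nonedge n E u v \<longleftrightarrow> u < n \<and> v < n \<and> u \<noteq> v \<and> (u, v) \<notin> E \<and> (v, u) \<notin> E"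

definition alpha :: "nat \<Rightarrow> (nat \<times> nat) set \<Rightarrow> enat" where
  "alpha n E = (if \<exists>u v. nonedge n E u v
                then enat (Min {cdist n u v | u v. nonedge n E u v}) else \<infinity>)"

definition beta :: "nat \<Rightarrow> (nat \<times> nat) set \<Rightarrow> nat" where
  "beta n E = (if E = {} then 0 else Max {cdist n u v | u v. (u, v) \<in> E})"

definition xi :: "nat \<Rightarrow> (nat \<times> nat) set \<Rightarrow> nat" where
  "xi n E = card {((u, v), (w, x)). (u, v) \<in> E \<and> nonedge n E w x \<and> cdist n u v > cdist n w x}"

definition P3t :: "(nat \<times> nat) set \<Rightarrow> nat" where
  "P3t E = card {(a, b, c). a \<noteq> b \<and> b \<noteq> c \<and> a \<noteq> c \<and> (a, b) \<in> E \<and> (b, c) \<in> E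
                  \<and> (a, c) \<notin> E \<and> (c, a) \<notin> E}"

definition optimal :: "nat \<Rightarrow> (nat \<times> nat) set \<Rightarrow> bool" where
  "optimal n E \<longleftrightarrow> two_free E \<and> circ_interval n E
     \<and> (\<forall>E'. two_free E' \<and> circ_interval n E' \<longrightarrow> P3t E' \<le> P3t E)
     \<and> (\<forall>E'. two_free E' \<and> circ_interval n E' \<and> P3t E' = P3t E \<longrightarrow> xi n E \<le> xi n E')"

end

theory Submission
  imports Defs
begin

text \<open>
  Write \<open>gain u v\<close> for the change of the path count when the non-edge \<open>(u, v)\<close> becomes an edge. For
  a pair \<open>(u, v)\<close> of length \<open>l\<close> that is a maximal edge or a minimal non-edge, it equals
  \<open>P + Q - 3T - (l - 1)\<close>, where \<open>P\<close> is the outdegree of \<open>v\<close>, \<open>Q\<close> the indegree of \<open>u\<close> and \<open>T\<close> the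
  number of \<open>c\<close> with \<open>v \<rightarrow> c \<rightarrow> u\<close>; moreover \<open>P + Q - T \<le> n - l - 1\<close>, with equality if \<open>T > 0\<close>.
  Deleting a longest edge shows \<open>2\<beta> \<le> n\<close>, from which \<open>\<alpha> \<le> \<beta> + 1\<close> is immediate.

  Suppose \<open>\<alpha> < \<beta>\<close>. Adding non-edges of length \<open>\<alpha>\<close> and deleting edges of length \<open>\<beta>\<close> keeps the
  digraph admissible and decreases \<open>\<xi>\<close>, so it must strictly decrease the path count. Doing this with a
  single pair gives \<open>3n - 1 \<le> 4(\<alpha> + \<beta>) \<le> 3n + 1\<close>, and doing it with a shortest non-edge and a longest
  edge sharing a vertex (where the two changes interact by \<open>+2\<close>) forces every shortest non-edge
  to be preceded and followed by longest edges, and vice versa. Hence exchanging all shortest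
  non-edges and all longest edges at once does not decrease the path count: a contradiction.
\<close>

section \<open>Change of the path count under insertion and deletion of edges\<close>

definition P3_local :: "(nat \<times> nat) set \<Rightarrow> nat \<Rightarrow> nat \<Rightarrow> nat \<Rightarrow> int" where
  "P3_local E u v c =
     of_bool ((v, c) \<in> E \<and> (u, c) \<notin> E \<and> (c, u) \<notin> E)
   + of_bool ((c, u) \<in> E \<and> (c, v) \<notin> E \<and> (v, c) \<notin> E)
   - of_bool ((u, c) \<in> E \<and> (c, v) \<in> E)
   - of_bool ((v, c) \<in> E \<and> (c, u) \<in> E)"

text \<open>The value ignores whether \<open>(u, v)\<close> itself lies in \<open>E\<close>, so one
  number measures both the insertion of a non-edge and, with opposite sign, the deletion of an
  edge.\<close>

definition P3_gain :: "nat \<Rightarrow> (nat \<times> nat) set \<Rightarrow> nat \<Rightarrow> nat \<Rightarrow> int" where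
  "P3_gain n E u v = (\<Sum>c \<in> {..<n} - {u, v}. P3_local E u v c)"

text \<open>The sets \<open>C1\<close> and \<open>C2\<close> index the induced paths u-v-c and c-u-v
  that are created. The sets \<open>C3\<close> and \<open>C4\<close> index the paths u-c-v and v-c-u
  that are lost because their ends become adjacent. No other triple changes status.\<close>

lemma P3t_insert:
  assumes E: "E \<subseteq> {0..<n} \<times> {0..<n}" and ne: "nonedge n E u v"
  shows "int (P3t (insert (u, v) E)) = int (P3t E) + P3_gain n E u v"
proof -
  define S where "S F = {(a, b, c). a \<noteq> b \<and> b \<noteq> c \<and> a \<noteq> c \<and> (a, b) \<in> F \<and> (b, c) \<in> F
                  \<and> (a, c) \<notin> F \<and> (c, a) \<notin> F}" for F :: "(nat \<times> nat) set"
  define C where "C = {..<n} - {u, v}"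
  define C1 where "C1 = {c \<in> C. (v, c) \<in> E \<and> (u, c) \<notin> E \<and> (c, u) \<notin> E}"
  define C2 where "C2 = {c \<in> C. (c, u) \<in> E \<and> (c, v) \<notin> E \<and> (v, c) \<notin> E}"
  define C3 where "C3 = {c \<in> C. (u, c) \<in> E \<and> (c, v) \<in> E}"
  define C4 where "C4 = {c \<in> C. (v, c) \<in> E \<and> (c, u) \<in> E}"
  define L where "L = (\<lambda>c. (u, c, v)) ` C3 \<union> (\<lambda>c. (v, c, u)) ` C4"
  define G where "G = (\<lambda>c. (u, v, c)) ` C1 \<union> (\<lambda>c. (c, u, v)) ` C2"
  have uv: "u < n" "v < n" "u \<noteq> v" "(u, v) \<notin> E" "(v, u) \<notin> E"
    using ne by (auto simp: nonedge_def)
  have lt: "a < n \<and> b < n" if "(a, b) \<in> E" for a b using E that by auto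
  have fin: "finite C" "finite C1" "finite C2" "finite C3" "finite C4"
    by (auto simp: C_def C1_def C2_def C3_def C4_def)
  have finL: "finite L" and finG: "finite G" using fin by (auto simp: L_def G_def)
  have cardL: "card L = card C3 + card C4"
    unfolding L_def using fin uv
    by (subst card_Un_disjoint) (auto simp: card_image inj_on_def)
  have cardG: "card G = card C1 + card C2"
    unfolding G_def using fin uv
    by (subst card_Un_disjoint) (auto simp: card_image inj_on_def)
  have "S E \<subseteq> {0..<n} \<times> {0..<n} \<times> {0..<n}"
    using lt by (fastforce simp: S_def)
  then have finS: "finite (S E)" by (rule finite_subset) auto
  have LS: "L \<subseteq> S E" using uv by (auto simp: L_def S_def C3_def C4_def C_def)
  have disj: "S E \<inter> G = {}" using uv by (auto simp: G_def S_def)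
  have "S (insert (u, v) E) = (S E - L) \<union> G"
  proof (rule set_eqI, clarify)
    fix a b c
    have 1: "(a, b, c) \<in> L \<longleftrightarrow> (a = u \<and> c = v \<or> a = v \<and> c = u) \<and> b \<in> C \<and> (a, b) \<in> E \<and> (b, c) \<in> E"
      by (auto simp: L_def C3_def C4_def)
    have 2: "(a, b, c) \<in> G \<longleftrightarrow> a = u \<and> b = v \<and> c \<in> C1 \<or> b = u \<and> c = v \<and> a \<in> C2"
      by (auto simp: G_def)
    show "(a, b, c) \<in> S (insert (u, v) E) \<longleftrightarrow> (a, b, c) \<in> (S E - L) \<union> G"
      using uv lt[of a b] lt[of b c]
      unfolding Un_iff Diff_iff 1 2 by (auto simp: S_def C_def C1_def C2_def)
  qed
  then have "card (S (insert (u, v) E)) = card (S E - L) + card G"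
    using finS finG disj by (simp add: card_Un_disjoint Int_Diff Diff_Int_distrib2)
  moreover have "card (S E - L) + card L = card (S E)"
    using finS LS finL by (metis card_Diff_subset card_mono le_add_diff_inverse2)
  ultimately have "int (card (S (insert (u, v) E)))
      = int (card (S E)) + int (card C1) + int (card C2) - int (card C3) - int (card C4)"
    using cardL cardG by linarith
  moreover have "P3_gain n E u v
      = int (card C1) + int (card C2) - int (card C3) - int (card C4)"
    unfolding P3_gain_def P3_local_def C_def[symmetric] sum.distrib sum_subtractf
      C1_def C2_def C3_def C4_def using fin(1)
    by (simp add: Int_def sum.If_cases)
  ultimately show ?thesis by (simp add: P3t_def S_def)
qed

lemma P3_gain_cong:
  assumes "\<And>c. c < n \<Longrightarrow> c \<noteq> u \<Longrightarrow> c \<noteq> v \<Longrightarrow>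
     ((u, c) \<in> E \<longleftrightarrow> (u, c) \<in> F) \<and> ((c, u) \<in> E \<longleftrightarrow> (c, u) \<in> F) \<and>
     ((v, c) \<in> E \<longleftrightarrow> (v, c) \<in> F) \<and> ((c, v) \<in> E \<longleftrightarrow> (c, v) \<in> F)"
  shows "P3_gain n E u v = P3_gain n F u v"
  unfolding P3_gain_def P3_local_def using assms by (intro sum.cong refl) auto

lemma P3t_remove:
  assumes E: "E \<subseteq> {0..<n} \<times> {0..<n}" and uv: "(u, v) \<in> E" "(v, u) \<notin> E" "u \<noteq> v"
  shows "int (P3t (E - {(u, v)})) = int (P3t E) - P3_gain n E u v"
proof -
  have "int (P3t (insert (u, v) (E - {(u, v)}))) =
      int (P3t (E - {(u, v)})) + P3_gain n (E - {(u, v)}) u v"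
    using assms by (intro P3t_insert) (auto simp: nonedge_def)
  moreover have "P3_gain n (E - {(u, v)}) u v = P3_gain n E u v"
    by (rule P3_gain_cong) auto
  moreover have "insert (u, v) (E - {(u, v)}) = E" using uv by auto
  ultimately show ?thesis by simp
qed

text \<open>A gain depends only on edges joining \<open>u\<close> or \<open>v\<close> to a third
  vertex. Pairs without a common vertex therefore do not influence each other, and their gains add
  up.\<close>

lemma P3t_insert_matching:
  assumes "finite X" and "E \<subseteq> {0..<n} \<times> {0..<n}"
    and "\<And>u v. (u, v) \<in> X \<Longrightarrow> nonedge n E u v"
    and "\<And>u v u' v'. (u, v) \<in> X \<Longrightarrow> (u', v') \<in> X \<Longrightarrow> (u, v) \<noteq> (u', v') \<Longrightarrow> {u, v} \<inter> {u', v'} = {}"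
  shows "int (P3t (E \<union> X)) = int (P3t E) + (\<Sum>(u, v)\<in>X. P3_gain n E u v)"
  using assms
proof (induction X rule: finite_induct)
  case (insert e X)
  obtain u v where e: "e = (u, v)" by fastforce
  have dis: "{u, v} \<inter> {u', v'} = {}" if "(u', v') \<in> X" for u' v'
    using insert.prems(3)[of u v u' v'] insert.hyps(2) that e by auto
  have ne: "nonedge n E u v" using insert.prems(2)[of u v] e by auto
  have sub: "X \<subseteq> {0..<n} \<times> {0..<n}" using insert.prems(2) by (force simp: nonedge_def)
  have "nonedge n (E \<union> X) u v"
    using ne dis[of u v] dis[of v u] by (auto simp: nonedge_def)
  then have "int (P3t (insert (u, v) (E \<union> X))) = int (P3t (E \<union> X)) + P3_gain n (E \<union> X) u v"
    using insert.prems(1) sub by (intro P3t_insert) auto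
  moreover have "P3_gain n (E \<union> X) u v = P3_gain n E u v"
    by (rule P3_gain_cong) (use dis in fastforce)
  moreover have "int (P3t (E \<union> X)) = int (P3t E) + (\<Sum>(u, v)\<in>X. P3_gain n E u v)"
    using insert.prems by (intro insert.IH) blast+
  moreover have "E \<union> insert e X = insert (u, v) (E \<union> X)" using e by auto
  ultimately show ?case using e insert.hyps by simp
qed simp

lemma P3t_remove_matching:
  assumes "finite X" and "E \<subseteq> {0..<n} \<times> {0..<n}"
    and "\<And>u v. (u, v) \<in> X \<Longrightarrow> (u, v) \<in> E \<and> (v, u) \<notin> E \<and> u \<noteq> v"
    and "\<And>u v u' v'. (u, v) \<in> X \<Longrightarrow> (u', v') \<in> X \<Longrightarrow> (u, v) \<noteq> (u', v') \<Longrightarrow> {u, v} \<inter> {u', v'} = {}"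
  shows "int (P3t (E - X)) = int (P3t E) - (\<Sum>(u, v)\<in>X. P3_gain n E u v)"
  using assms
proof (induction X rule: finite_induct)
  case (insert e X)
  obtain u v where e: "e = (u, v)" by fastforce
  have dis: "{u, v} \<inter> {u', v'} = {}" if "(u', v') \<in> X" for u' v'
    using insert.prems(3)[of u v u' v'] insert.hyps(2) that e by auto
  have g: "(u, v) \<in> E" "(v, u) \<notin> E" "u \<noteq> v" using insert.prems(2)[of u v] e by auto
  have "int (P3t ((E - X) - {(u, v)})) = int (P3t (E - X)) - P3_gain n (E - X) u v"
    using insert.prems(1) g dis[of u v] by (intro P3t_remove) auto
  moreover have "P3_gain n (E - X) u v = P3_gain n E u v"
    by (rule P3_gain_cong) (use dis in fastforce)
  moreover have "int (P3t (E - X)) = int (P3t E) - (\<Sum>(u, v)\<in>X. P3_gain n E u v)"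
    using insert.prems by (intro insert.IH) blast+
  moreover have "E - insert e X = (E - X) - {(u, v)}" using e by auto
  ultimately show ?case using e insert.hyps by simp
qed simp

text \<open>Adding \<open>(u, v)\<close> creates an induced path on \<open>a, u, v\<close> before the insertion, and destroys one
by closing a cyclic triangle after it; hence the loss of 2.\<close>

lemma P3_gain_insert_tail:
  assumes "a < n" "a \<noteq> u" "a \<noteq> v" "(a, u) \<notin> E" "(u, a) \<notin> E" "(v, a) \<in> E" "(a, v) \<notin> E"
  shows "P3_gain n (insert (a, u) E) u v = P3_gain n E u v - 2"
proof -
  let ?C = "{..<n} - {u, v}"
  have "P3_gain n F u v = P3_local F u v a + (\<Sum>c \<in> ?C - {a}. P3_local F u v c)" for F
    unfolding P3_gain_def using assms by (subst sum.remove[of _ a]) auto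
  moreover have "P3_local (insert (a, u) E) u v a = P3_local E u v a - 2"
    using assms by (auto simp: P3_local_def)
  moreover have "(\<Sum>c \<in> ?C - {a}. P3_local (insert (a, u) E) u v c) = (\<Sum>c \<in> ?C - {a}. P3_local E u v c)"
    using assms by (intro sum.cong refl) (auto simp: P3_local_def)
  ultimately show ?thesis by simp
qed

text \<open>Mirror image of \<open>P3_gain_insert_tail\<close> under reversal of all edges.\<close>

lemma P3_gain_insert_head:
  assumes "a < n" "a \<noteq> u" "a \<noteq> v" "(v, a) \<notin> E" "(a, v) \<notin> E" "(a, u) \<in> E" "(u, a) \<notin> E"
  shows "P3_gain n (insert (v, a) E) u v = P3_gain n E u v - 2"
proof -
  let ?C = "{..<n} - {u, v}"
  have "P3_gain n F u v = P3_local F u v a + (\<Sum>c \<in> ?C - {a}. P3_local F u v c)" for F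
    unfolding P3_gain_def using assms by (subst sum.remove[of _ a]) auto
  moreover have "P3_local (insert (v, a) E) u v a = P3_local E u v a - 2"
    using assms by (auto simp: P3_local_def)
  moreover have "(\<Sum>c \<in> ?C - {a}. P3_local (insert (v, a) E) u v c) = (\<Sum>c \<in> ?C - {a}. P3_local E u v c)"
    using assms by (intro sum.cong refl) (auto simp: P3_local_def)
  ultimately show ?thesis by simp
qed

section \<open>Arithmetic of clockwise distances\<close>

text \<open>Replaces the modulus by two linear cases, so that facts about arcs become linear
  arithmetic.\<close>

lemma cdist_if:
  assumes "u < n" "v < n"
  shows "cdist n u v = (if u \<le> v then v - u else v + n - u)"
proof (cases "u \<le> v")
  case True
  then have eq: "v + n - u = (v - u) + n" by simp
  show ?thesis using assms True by (simp only: cdist_def eq mod_add_self2) simp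
qed (use assms in \<open>simp add: cdist_def\<close>)

lemma cdist_less: "u < n \<Longrightarrow> cdist n u v < n" by (simp add: cdist_def)

lemma cdist_pos: "u < n \<Longrightarrow> v < n \<Longrightarrow> 0 < cdist n u v \<longleftrightarrow> u \<noteq> v"
  by (auto simp: cdist_if)

lemma cdist_swap: "u < n \<Longrightarrow> v < n \<Longrightarrow> u \<noteq> v \<Longrightarrow> cdist n v u = n - cdist n u v"
  by (auto simp: cdist_if)

lemma cdist_from_inner:
  "u < n \<Longrightarrow> c < n \<Longrightarrow> w < n \<Longrightarrow> cdist n u c \<le> cdist n u w \<Longrightarrow> cdist n c w = cdist n u w - cdist n u c"
  by (simp add: cdist_if split: if_splits)

lemma cdist_to_inner:
  "u < n \<Longrightarrow> c < n \<Longrightarrow> w < n \<Longrightarrow> cdist n c w \<le> cdist n u w \<Longrightarrow> cdist n u c = cdist n u w - cdist n c w"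
  by (simp add: cdist_if split: if_splits)

lemma ex_head_cdist: "v < n \<Longrightarrow> k < n \<Longrightarrow> \<exists>c<n. cdist n v c = k"
  by (rule exI[of _ "if v + k < n then v + k else v + k - n"]) (auto simp: cdist_if)

lemma ex_tail_cdist: "v < n \<Longrightarrow> k < n \<Longrightarrow> \<exists>c<n. cdist n c v = k"
  by (rule exI[of _ "if k \<le> v then v - k else v + n - k"]) (auto simp: cdist_if)

lemma cdist_head_inj: "v < n \<Longrightarrow> c < n \<Longrightarrow> c' < n \<Longrightarrow> cdist n v c = cdist n v c' \<Longrightarrow> c = c'"
  by (auto simp: cdist_if split: if_splits)

lemma cdist_tail_inj: "v < n \<Longrightarrow> c < n \<Longrightarrow> c' < n \<Longrightarrow> cdist n c v = cdist n c' v \<Longrightarrow> c = c'"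
  by (auto simp: cdist_if split: if_splits)

lemma card_cdist_heads:
  assumes "v < n" "k < n"
  shows "card {c. c < n \<and> 0 < cdist n v c \<and> cdist n v c \<le> k} = k"
proof -
  have "bij_betw (cdist n v) {c. c < n \<and> 0 < cdist n v c \<and> cdist n v c \<le> k} {1..k}"
    unfolding bij_betw_def
  proof
    show "inj_on (cdist n v) {c. c < n \<and> 0 < cdist n v c \<and> cdist n v c \<le> k}"
      using cdist_head_inj assms by (auto simp: inj_on_def)
    show "cdist n v ` {c. c < n \<and> 0 < cdist n v c \<and> cdist n v c \<le> k} = {1..k}"
    proof (rule set_eqI)
      fix j
      show "j \<in> cdist n v ` {c. c < n \<and> 0 < cdist n v c \<and> cdist n v c \<le> k} \<longleftrightarrow> j \<in> {1..k}"
        using ex_head_cdist[OF assms(1), of j] assms(2) by (auto simp: image_iff Suc_le_eq)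
    qed
  qed
  then show ?thesis using bij_betw_same_card by fastforce
qed

lemma card_cdist_tails:
  assumes "v < n" "k < n"
  shows "card {c. c < n \<and> 0 < cdist n c v \<and> cdist n c v \<le> k} = k"
proof -
  have "bij_betw (\<lambda>c. cdist n c v) {c. c < n \<and> 0 < cdist n c v \<and> cdist n c v \<le> k} {1..k}"
    unfolding bij_betw_def
  proof
    show "inj_on (\<lambda>c. cdist n c v) {c. c < n \<and> 0 < cdist n c v \<and> cdist n c v \<le> k}"
      using cdist_tail_inj assms by (auto simp: inj_on_def)
    show "(\<lambda>c. cdist n c v) ` {c. c < n \<and> 0 < cdist n c v \<and> cdist n c v \<le> k} = {1..k}"
    proof (rule set_eqI)
      fix j
      show "j \<in> (\<lambda>c. cdist n c v) ` {c. c < n \<and> 0 < cdist n c v \<and> cdist n c v \<le> k} \<longleftrightarrow> j \<in> {1..k}"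
        using ex_tail_cdist[OF assms(1), of j] assms(2) by (auto simp: image_iff Suc_le_eq)
    qed
  qed
  then show ?thesis using bij_betw_same_card by fastforce
qed

section \<open>Extremal pairs in 2-free circular interval digraphs\<close>

locale interval_digraph =
  fixes n :: nat and E :: "(nat \<times> nat) set"
  assumes two_free: "two_free E" and circ: "circ_interval n E"
begin

definition outdeg :: "nat \<Rightarrow> int" where "outdeg v = int (card {c. (v, c) \<in> E})"

definition indeg :: "nat \<Rightarrow> int" where "indeg v = int (card {c. (c, v) \<in> E})"

text \<open>For a pair \<open>(u, v)\<close> this is taken at \<open>v\<close>, \<open>u\<close>: it
  counts the cyclic triangles that the edge \<open>(u, v)\<close> completes.\<close>

definition common :: "nat \<Rightarrow> nat \<Rightarrow> int" where
  "common v u = int (card {c. (v, c) \<in> E \<and> (c, u) \<in> E})"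

text \<open>The ordered pairs that are maximal as edges or minimal as non-edges, with respect to
inclusion of arcs.\<close>

definition extremal :: "nat \<Rightarrow> nat \<Rightarrow> bool" where
  "extremal u v \<longleftrightarrow> u < n \<and> v < n \<and> u \<noteq> v \<and> (v, u) \<notin> E \<and>
     (\<forall>c<n. 0 < cdist n u c \<and> cdist n u c < cdist n u v \<longrightarrow> (u, c) \<in> E \<and> (c, v) \<in> E) \<and>
     (\<forall>c<n. cdist n u v < cdist n u c \<longrightarrow> (u, c) \<notin> E) \<and>
     (\<forall>c<n. cdist n u v < cdist n c v \<longrightarrow> (c, v) \<notin> E)"

lemma edgeD: "(u, v) \<in> E \<Longrightarrow> u < n \<and> v < n \<and> u \<noteq> v"
proof -
  have "digraph n E" using circ by (simp only: circ_interval_def)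
  then show "(u, v) \<in> E \<Longrightarrow> u < n \<and> v < n \<and> u \<noteq> v" by (auto simp: digraph_def)
qed

lemma edges_subset: "E \<subseteq> {0..<n} \<times> {0..<n}"
  using edgeD by auto

lemma edge_asym: "(u, v) \<in> E \<Longrightarrow> (v, u) \<notin> E"
  using two_free edgeD by (auto simp: two_free_def)

lemma interval:
  assumes "(u, w) \<in> E" "c < n" "0 < cdist n u c" "cdist n u c < cdist n u w"
  shows "(u, c) \<in> E" "(c, w) \<in> E"
proof -
  have "clockwise n u c w"
    using assms edgeD[OF assms(1)] by (auto simp: clockwise_def cdist_pos)
  then show "(u, c) \<in> E" "(c, w) \<in> E"
    using circ assms(1) unfolding circ_interval_def by blast+
qed

lemma finite_E: "finite E" using edges_subset by (rule finite_subset) simp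

lemma finite_nbrs: "finite {c. (v, c) \<in> E}" "finite {c. (c, v) \<in> E}"
proof -
  have "{c. (v, c) \<in> E} \<subseteq> {..<n}" "{c. (c, v) \<in> E} \<subseteq> {..<n}" using edgeD by auto
  then show "finite {c. (v, c) \<in> E}" "finite {c. (c, v) \<in> E}"
    using finite_subset finite_lessThan by blast+
qed

text \<open>Each of the l - 1 vertices inside the arc from \<open>u\<close> to \<open>v\<close> is
  the middle of a path from \<open>u\<close> to \<open>v\<close> and contributes -1. For a vertex
  outside the arc, neither \<open>(u, c)\<close> nor \<open>(c, v)\<close> is an edge. It
  contributes 1 if exactly one of \<open>(v, c)\<close>, \<open>(c, u)\<close> is an edge and -1 if
  both are, which is where the coefficient 3 comes from.\<close>

lemma gain_extremal:
  assumes ex: "extremal u v"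
  shows "P3_gain n E u v = outdeg v + indeg u - 3 * common v u - (int (cdist n u v) - 1)"
proof -
  let ?l = "cdist n u v"
  let ?C = "{..<n} - {u, v}"
  have uv: "u < n" "v < n" "u \<noteq> v" "(v, u) \<notin> E" using ex by (auto simp: extremal_def)
  have loc: "P3_local E u v c = of_bool ((v, c) \<in> E) + of_bool ((c, u) \<in> E)
      - 3 * of_bool ((v, c) \<in> E \<and> (c, u) \<in> E) - of_bool (0 < cdist n u c \<and> cdist n u c < ?l)"
    if c: "c \<in> ?C" for c
  proof (cases "cdist n u c < ?l")
    case True
    then have "(u, c) \<in> E" "(c, v) \<in> E" "0 < cdist n u c"
      using ex c uv by (auto simp: extremal_def cdist_pos)
    then show ?thesis using True edge_asym by (auto simp: P3_local_def)
  next
    case False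
    then have "?l < cdist n u c" "?l < cdist n c v"
      using c uv by (auto simp: cdist_if split: if_splits)
    then have "(u, c) \<notin> E" "(c, v) \<notin> E" using ex c by (auto simp: extremal_def)
    then show ?thesis using False by (auto simp: P3_local_def)
  qed
  have 1: "(\<Sum>c\<in>?C. of_bool ((v, c) \<in> E)) = outdeg v"
  proof -
    have "?C \<inter> {c. (v, c) \<in> E} = {c. (v, c) \<in> E}" using edgeD uv by auto
    then show ?thesis by (simp add: outdeg_def)
  qed
  have 2: "(\<Sum>c\<in>?C. of_bool ((c, u) \<in> E)) = indeg u"
  proof -
    have "?C \<inter> {c. (c, u) \<in> E} = {c. (c, u) \<in> E}" using edgeD uv by auto
    then show ?thesis by (simp add: indeg_def)
  qed
  have 3: "(\<Sum>c\<in>?C. of_bool ((v, c) \<in> E \<and> (c, u) \<in> E)) = common v u"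
  proof -
    have "?C \<inter> {c. (v, c) \<in> E \<and> (c, u) \<in> E} = {c. (v, c) \<in> E \<and> (c, u) \<in> E}"
      using edgeD uv by auto
    then show ?thesis by (simp add: common_def del: of_bool_conj)
  qed
  have 4: "(\<Sum>c\<in>?C. of_bool (0 < cdist n u c \<and> cdist n u c < ?l)) = int ?l - 1"
  proof -
    have pos: "0 < ?l" using uv by (simp add: cdist_pos)
    have "?C \<inter> {c. 0 < cdist n u c \<and> cdist n u c < ?l}
        = {c. c < n \<and> 0 < cdist n u c \<and> cdist n u c \<le> ?l - 1}"
      using pos by (auto simp: cdist_if[of u n u] uv)
    moreover have "card \<dots> = ?l - 1"
      using uv cdist_less[of u n v] by (intro card_cdist_heads) auto
    ultimately show ?thesis using pos by (simp add: of_nat_diff del: of_bool_conj)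
  qed
  show ?thesis
    unfolding P3_gain_def using loc
    by (simp add: sum.distrib sum_subtractf 1 2 3 4 flip: sum_distrib_left del: of_bool_conj)
qed

text \<open>All out-neighbours of \<open>v\<close> and in-neighbours of \<open>u\<close> lie
  strictly between \<open>v\<close> and \<open>u\<close> on the complementary arc, and the left side
  is the size of their union. A common neighbour \<open>d\<close> forces equality: by the interval
  property every vertex before \<open>d\<close> is an out-neighbour of \<open>v\<close> and every
  vertex after \<open>d\<close> an in-neighbour of \<open>u\<close>.\<close>

lemma degrees_extremal_le:
  assumes ex: "extremal u v"
  shows "outdeg v + indeg u - common v u \<le> int n - int (cdist n u v) - 1"
    and "0 < common v u \<Longrightarrow> outdeg v + indeg u - common v u = int n - int (cdist n u v) - 1"
proof -
  let ?l = "cdist n u v"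
  let ?A = "{c. (v, c) \<in> E}" and ?B = "{c. (c, u) \<in> E}"
  let ?M = "{c. c < n \<and> 0 < cdist n v c \<and> cdist n v c \<le> n - ?l - 1}"
  have uv: "u < n" "v < n" "u \<noteq> v" "(v, u) \<notin> E" using ex by (auto simp: extremal_def)
  have l: "0 < ?l" "?l < n" "cdist n v u = n - ?l"
    using uv cdist_swap[of u n v] by (auto simp: cdist_pos cdist_less)
  have "?A \<inter> ?B = {c. (v, c) \<in> E \<and> (c, u) \<in> E}" by auto
  then have un: "int (card (?A \<union> ?B)) = outdeg v + indeg u - common v u"
    using card_Un_Int[of ?A ?B] finite_nbrs by (simp add: outdeg_def indeg_def common_def)
  have M: "card ?M = n - ?l - 1" using uv l by (intro card_cdist_heads) auto
  have sub: "?A \<union> ?B \<subseteq> ?M"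
  proof
    fix c assume "c \<in> ?A \<union> ?B"
    then consider "(v, c) \<in> E" | "(c, u) \<in> E" by auto
    then show "c \<in> ?M"
    proof cases
      case 1
      then have c: "c < n" "v \<noteq> c" "c \<noteq> u" using edgeD uv by auto
      \<comment> \<open>An edge from \<open>v\<close> reaching past \<open>u\<close> would contain
        \<open>(v, u)\<close>, which extremality excludes.\<close>
      have "\<not> cdist n v u < cdist n v c" using interval[OF 1, of u] uv l by auto
      moreover have "cdist n v u \<noteq> cdist n v c" using cdist_head_inj c uv by blast
      ultimately show ?thesis using l c uv by (simp add: cdist_pos)
    next
      case 2
      then have c: "c < n" "v \<noteq> c" "c \<noteq> u" using edgeD uv by auto
      have "(u, c) \<notin> E" using 2 edge_asym by blast
      then have "\<not> cdist n u c < ?l" using ex c uv by (auto simp: extremal_def cdist_pos)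
      then have "cdist n v c < n - ?l" using uv c
        by (auto simp: cdist_if split: if_splits)
      then show ?thesis using c uv by (auto simp: cdist_pos)
    qed
  qed
  have "card (?A \<union> ?B) \<le> card ?M" by (rule card_mono[OF _ sub]) auto
  then show "outdeg v + indeg u - common v u \<le> int n - int ?l - 1"
    using un M l by linarith
  assume "0 < common v u"
  then have "{c. (v, c) \<in> E \<and> (c, u) \<in> E} \<noteq> {}" unfolding common_def by (metis card.empty of_nat_0 less_irrefl)
  then obtain d where d: "(v, d) \<in> E" "(d, u) \<in> E" by auto
  have dn: "d < n" "d \<noteq> v" "d \<noteq> u" using edgeD d by auto
  have dM: "cdist n v d < n - ?l" using sub d l by fastforce
  have "?M \<subseteq> ?A \<union> ?B"
  proof
    fix c assume c: "c \<in> ?M"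
    then have cl: "cdist n v c < n - ?l" using l by auto
    have "c \<noteq> u" using cl l by auto
    consider "cdist n v c < cdist n v d" | "c = d" | "cdist n v d < cdist n v c"
      using cdist_head_inj[of v n c d] c uv dn by force
    then show "c \<in> ?A \<union> ?B"
    proof cases
      case 1 then show ?thesis using interval[OF d(1)] c by auto
    next
      case 2 then show ?thesis using d by auto
    next
      case 3
      then have "0 < cdist n d c" "cdist n d c < cdist n d u"
        using cl c dn uv l cdist_from_inner[of v n d c] cdist_from_inner[of v n d u] by auto
      then show ?thesis using interval[OF d(2)] c by auto
    qed
  qed
  with sub have "?A \<union> ?B = ?M" by (rule subset_antisym)
  then have "card (?A \<union> ?B) = card ?M" by (rule arg_cong)
  then show "outdeg v + indeg u - common v u = int n - int ?l - 1"
    using un M l by linarith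
qed

text \<open>The interval property only demands pairs strictly inside an edge. These are shorter than
  \<open>b\<close> and hence survive.\<close>

lemma remove_longest:
  assumes Y: "\<And>u v. (u, v) \<in> Y \<Longrightarrow> cdist n u v = b"
    and b: "\<And>u v. (u, v) \<in> E \<Longrightarrow> cdist n u v \<le> b"
  shows "two_free (E - Y)" "circ_interval n (E - Y)"
proof -
  show "two_free (E - Y)" using two_free by (auto simp: two_free_def)
  have "(u, v) \<in> E - Y \<and> (v, w) \<in> E - Y" if "clockwise n u v w" "(u, w) \<in> E - Y" for u v w
  proof -
    have E: "(u, v) \<in> E" "(v, w) \<in> E" using that circ unfolding circ_interval_def by blast+
    have "cdist n u v < cdist n u w" "cdist n v w < cdist n u w"
      using that(1) by (auto simp: clockwise_def cdist_if split: if_splits)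
    then have "cdist n u v < b" "cdist n v w < b" using b[of u w] that by auto
    then show ?thesis using E Y by fastforce
  qed
  moreover have "digraph n (E - Y)" using edges_subset edgeD by (auto simp: digraph_def)
  ultimately show "circ_interval n (E - Y)" unfolding circ_interval_def by blast
qed

lemma extremal_longest:
  assumes "(u, v) \<in> E" "cdist n u v = b" and b: "\<And>u v. (u, v) \<in> E \<Longrightarrow> cdist n u v \<le> b"
  shows "extremal u v"
proof -
  have long: "(x, y) \<notin> E" if "b < cdist n x y" for x y using b[of x y] that by auto
  show ?thesis
    unfolding extremal_def assms(2)
  proof (intro conjI allI impI)
    fix c assume "c < n" "0 < cdist n u c \<and> cdist n u c < b"
    then show "(u, c) \<in> E" "(c, v) \<in> E" using interval[OF assms(1)] assms(2) by blast+
  qed (use edgeD[OF assms(1)] edge_asym[OF assms(1)] long in blast)+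
qed

text \<open>Deleting one longest edge cannot increase the path count, so its gain is nonnegative. By
  the two preceding estimates that gain is at most n - 2b - 2T, where T is
  \<open>common v u\<close>.\<close>

lemma longest_le_half:
  assumes opt: "\<And>F. two_free F \<Longrightarrow> circ_interval n F \<Longrightarrow> P3t F \<le> P3t E"
    and e: "(u, v) \<in> E" "cdist n u v = b" and b: "\<And>u v. (u, v) \<in> E \<Longrightarrow> cdist n u v \<le> b"
  shows "2 * b \<le> n"
proof -
  have ex: "extremal u v" using extremal_longest[OF e b] .
  have "P3t (E - {(u, v)}) \<le> P3t E"
  proof (rule opt)
    show "two_free (E - {(u, v)})" "circ_interval n (E - {(u, v)})"
      by (rule remove_longest[of _ b]; use e(2) b in blast)+
  qed
  then have "P3_gain n E u v \<ge> 0"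
    using P3t_remove[OF edges_subset e(1)] edge_asym[OF e(1)] edgeD[OF e(1)] by simp
  then show ?thesis
    using gain_extremal[OF ex] degrees_extremal_le(1)[OF ex] e(2)
    by (simp add: common_def)
qed

end

section \<open>The case \<open>a < b\<close>: admissible modifications\<close>

locale unbalanced = interval_digraph +
  fixes a b :: nat
  assumes max_P3: "two_free F \<Longrightarrow> circ_interval n F \<Longrightarrow> P3t F \<le> P3t E"
    and min_xi: "two_free F \<Longrightarrow> circ_interval n F \<Longrightarrow> P3t F = P3t E \<Longrightarrow> xi n E \<le> xi n F"
    and edge_le: "(u, v) \<in> E \<Longrightarrow> cdist n u v \<le> b"
    and nonedge_ge: "nonedge n E u v \<Longrightarrow> a \<le> cdist n u v"
    and ex_edge: "\<exists>u v. (u, v) \<in> E \<and> cdist n u v = b"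
    and ex_nonedge: "\<exists>u v. nonedge n E u v \<and> cdist n u v = a"
    and a_less_b: "a < b"
begin

definition long :: "nat \<Rightarrow> nat \<Rightarrow> bool" where
  "long u v \<longleftrightarrow> (u, v) \<in> E \<and> cdist n u v = b"

definition short :: "nat \<Rightarrow> nat \<Rightarrow> bool" where
  "short w x \<longleftrightarrow> nonedge n E w x \<and> cdist n w x = a"

lemma longD: "long u v \<Longrightarrow> u < n \<and> v < n \<and> u \<noteq> v \<and> (u, v) \<in> E \<and> (v, u) \<notin> E \<and> cdist n u v = b"
  using edgeD edge_asym by (auto simp: long_def)

lemma shortD: "short w x \<Longrightarrow> w < n \<and> x < n \<and> w \<noteq> x \<and> (w, x) \<notin> E \<and> (x, w) \<notin> E \<and> cdist n w x = a"
  by (auto simp: short_def nonedge_def)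

lemma b_le_half: "2 * b \<le> n"
proof -
  obtain u v where "(u, v) \<in> E" "cdist n u v = b" using ex_edge by blast
  then show ?thesis using longest_le_half max_P3 edge_le by blast
qed

lemma a_pos: "0 < a"
  using ex_nonedge by (auto simp: nonedge_def cdist_pos)

text \<open>A pair this close is not a non-edge, and the reversed edge would have length greater
  than n - a, which exceeds \<open>b\<close>.\<close>

lemma edge_if_close:
  assumes "u < n" "v < n" "u \<noteq> v" "cdist n u v < a"
  shows "(u, v) \<in> E"
proof (rule ccontr)
  assume "(u, v) \<notin> E"
  moreover have "\<not> nonedge n E u v" using nonedge_ge[of u v] assms(4) by auto
  ultimately have "(v, u) \<in> E" using assms by (auto simp: nonedge_def)
  then have "n - cdist n u v \<le> b" using edge_le cdist_swap[of u n v] assms by fastforce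
  then show False using assms(4) a_less_b b_le_half by linarith
qed

text \<open>The non-edge would lie inside the longer edge and so be an edge by the interval
  property.\<close>

lemma not_short_and_long_tail: "short u v \<Longrightarrow> long u w \<Longrightarrow> False"
  using shortD[of u v] longD[of u w] interval[of u w v] a_pos a_less_b by auto

lemma not_short_and_long_head:
  assumes "short v w" "long u w" shows False
proof -
  have "0 < cdist n u v" "cdist n u v < cdist n u w"
    using shortD[OF assms(1)] longD[OF assms(2)] a_pos a_less_b
    by (auto simp: cdist_if split: if_splits)
  then show False
    using shortD[OF assms(1)] longD[OF assms(2)] interval[of u w v] by auto
qed

text \<open>Two opposite edges could only arise from two opposite short pairs, which would give 2a =
  n although 2a < 2b \<le> n. Pairs strictly inside an old edge or inside a short pair are already
  edges, and they are shorter than \<open>b\<close>, so none of them is deleted.\<close>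

lemma modified_interval:
  assumes X: "\<And>u v. (u, v) \<in> X \<Longrightarrow> short u v" and Y: "\<And>u v. (u, v) \<in> Y \<Longrightarrow> long u v"
  shows "two_free (E \<union> X - Y)" "circ_interval n (E \<union> X - Y)"
proof -
  have "(v, u) \<notin> E \<union> X" if "(u, v) \<in> E \<union> X" for u v
  proof
    assume vu: "(v, u) \<in> E \<union> X"
    have "short u v \<and> short v u"
      using that vu edge_asym[of u v] X[of u v] X[of v u] shortD[of u v] shortD[of v u] by blast
    then have "2 * a = n" using cdist_swap[of u n v] shortD[of u v] shortD[of v u]
      cdist_less[of u n v] by auto
    then show False using a_less_b b_le_half by linarith
  qed
  then show "two_free (E \<union> X - Y)" unfolding two_free_def by blast
  have "(u, v) \<in> E \<union> X - Y \<and> (v, w) \<in> E \<union> X - Y"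
    if cw: "clockwise n u v w" and uw: "(u, w) \<in> E \<union> X - Y" for u v w
  proof -
    have less: "cdist n u v < cdist n u w" "cdist n v w < cdist n u w"
      and lt: "u < n" "v < n" "w < n" "u \<noteq> v" "v \<noteq> w"
      using cw by (auto simp: clockwise_def cdist_if split: if_splits)
    consider "(u, w) \<in> E" | "(u, w) \<in> X" using uw by blast
    then have "(u, v) \<in> E \<and> (v, w) \<in> E \<and> cdist n u w \<le> b"
    proof cases
      case 1
      then show ?thesis using interval[OF 1 lt(2)] less lt edge_le by (auto simp: cdist_pos)
    next
      case 2
      then have "cdist n u w = a" using X shortD by blast
      then show ?thesis using edge_if_close lt less a_less_b by auto
    qed
    then have "(u, v) \<in> E" "(v, w) \<in> E" "cdist n u v \<noteq> b" "cdist n v w \<noteq> b" using less by auto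
    then show ?thesis using Y longD by blast
  qed
  moreover have "digraph n (E \<union> X - Y)"
    using edgeD X shortD by (fastforce simp: digraph_def)
  ultimately show "circ_interval n (E \<union> X - Y)" unfolding circ_interval_def by blast
qed

text \<open>No new pair is counted: an added edge has length \<open>a\<close>, and a newly created
  non-edge has length at least \<open>b\<close>. Some counted pair disappears, namely a modified
  pair together with any long edge or any short non-edge.\<close>

lemma modified_xi:
  assumes X: "\<And>u v. (u, v) \<in> X \<Longrightarrow> short u v" and Y: "\<And>u v. (u, v) \<in> Y \<Longrightarrow> long u v"
    and ne: "X \<union> Y \<noteq> {}"
  shows "xi n (E \<union> X - Y) < xi n E"
proof -
  define F where "F = E \<union> X - Y"
  define S where "S G = {((u, v), (w, x)). (u, v) \<in> G \<and> nonedge n G w x \<and> cdist n u v > cdist n w x}"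
    for G
  have ab: "a < b" "2 * b \<le> n" using a_less_b b_le_half by auto
  have "finite (E \<times> ({..<n} \<times> {..<n}))" using finite_E by simp
  moreover have "S E \<subseteq> E \<times> ({..<n} \<times> {..<n})" by (auto simp: S_def nonedge_def)
  ultimately have fin: "finite (S E)" by (rule rev_finite_subset)
  have F_le: "cdist n u v \<le> b" if "(u, v) \<in> F" for u v
    using that X shortD edge_le ab unfolding F_def by (metis DiffD1 UnE less_imp_le)
  have non: "nonedge n E w x \<or> b \<le> cdist n w x" if "nonedge n F w x" for w x
  proof -
    \<comment> \<open>Deleting a long edge creates non-edges in both orientations; the reversed one
      has length n - b, and 2b \<le> n.\<close>
    have "b \<le> cdist n w x" if "long w x \<or> long x w"
      using that longD[of w x] longD[of x w] cdist_swap[of x n w] ab by auto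
    then show ?thesis using that Y by (auto simp: F_def nonedge_def)
  qed
  have "S F \<subseteq> S E"
  proof (clarsimp simp: S_def)
    fix u v w x assume *: "(u, v) \<in> F" "nonedge n F w x" "cdist n w x < cdist n u v"
    have nE: "nonedge n E w x" using non[OF *(2)] F_le[OF *(1)] *(3) by auto
    moreover have "(u, v) \<in> E"
    proof (rule ccontr)
      assume "(u, v) \<notin> E"
      then have "cdist n u v = a" using *(1) X shortD unfolding F_def by blast
      then show False using nonedge_ge[OF nE] *(3) by simp
    qed
    ultimately show "(u, v) \<in> E \<and> nonedge n E w x" by simp
  qed
  moreover have "S F \<noteq> S E"
  proof -
    obtain u0 v0 where l0: "long u0 v0" using ex_edge by (auto simp: long_def)
    obtain w0 x0 where s0: "short w0 x0" using ex_nonedge by (auto simp: short_def)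
    have inE: "((u, v), (w, x)) \<in> S E" if "long u v" "short w x" for u v w x
      using that ab by (auto simp: S_def long_def short_def)
    consider u v where "(u, v) \<in> X" | u v where "(u, v) \<in> Y" using ne by auto
    then show ?thesis
    proof cases
      case 1
      then have "(u, v) \<in> F" using X[OF 1] Y shortD longD unfolding F_def by blast
      then have "((u0, v0), (u, v)) \<notin> S F" by (auto simp: S_def nonedge_def)
      then show ?thesis using inE[OF l0 X[OF 1]] by auto
    next
      case 2
      then have "((u, v), (w0, x0)) \<notin> S F" by (auto simp: S_def F_def)
      then show ?thesis using inE[OF Y[OF 2] s0] by auto
    qed
  qed
  ultimately have "card (S F) < card (S E)" using fin by (intro psubset_card_mono) auto
  then show ?thesis by (simp add: xi_def S_def F_def)
qed

text \<open>Equality of the path counts would contradict the minimality of \<xi>. Strictness here is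
  the source of all the inequalities below.\<close>

lemma modified_P3t:
  assumes "\<And>u v. (u, v) \<in> X \<Longrightarrow> short u v" "\<And>u v. (u, v) \<in> Y \<Longrightarrow> long u v" "X \<union> Y \<noteq> {}"
  shows "P3t (E \<union> X - Y) < P3t E"
  using max_P3[OF modified_interval[OF assms(1,2)]] min_xi[OF modified_interval[OF assms(1,2)]]
    modified_xi[OF assms] by fastforce

section \<open>Degrees and gains of shortest non-edges and longest edges\<close>

lemma extremal_long: "long u v \<Longrightarrow> extremal u v"
  using extremal_longest edge_le by (auto simp: long_def)

lemma extremal_short:
  assumes s: "short w x" shows "extremal w x"
  unfolding extremal_def
proof (intro conjI allI impI)
  note d = shortD[OF s]
  show "w < n" "x < n" "w \<noteq> x" "(x, w) \<notin> E" using d by auto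
  fix c assume c: "c < n"
  { assume "0 < cdist n w c \<and> cdist n w c < cdist n w x"
    moreover from this have "c \<noteq> x" "w \<noteq> c" using cdist_pos c d by auto
    moreover from calculation have "cdist n c x < a" using d c by (auto simp: cdist_if split: if_splits)
    ultimately show "(w, c) \<in> E" "(c, x) \<in> E" using edge_if_close c d by auto }
  { assume "cdist n w x < cdist n w c"
    then show "(w, c) \<notin> E" using interval(1)[of w c x] d a_pos by auto }
  { assume "cdist n w x < cdist n c x"
    then have "0 < cdist n c w" "cdist n c w < cdist n c x"
      using d c a_pos by (auto simp: cdist_if split: if_splits)
    then show "(c, x) \<notin> E" using interval(2)[of c x w] d by auto }
qed

lemma gain_short:
  assumes s: "short w x" shows "P3_gain n E w x \<le> -1"
proof -
  have "P3t (E \<union> {(w, x)} - {}) < P3t E" using s by (intro modified_P3t) auto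
  then show ?thesis using P3t_insert[OF edges_subset, of w x] s by (simp add: short_def)
qed

lemma gain_long:
  assumes l: "long u v" shows "P3_gain n E u v \<ge> 1"
proof -
  have "P3t (E \<union> {} - {(u, v)}) < P3t E" using l by (intro modified_P3t) auto
  then show ?thesis using P3t_remove[OF edges_subset, of u v] longD[OF l] by simp
qed

lemma b_less_n: "b < n"
  using b_le_half a_less_b by linarith

text \<open>The out-neighbourhood of \<open>v\<close> contains the first a - 1 vertices after
  \<open>v\<close> and lies within the first \<open>b\<close>. Degree \<open>b\<close> requires the
  vertex at distance \<open>b\<close>, and degree a - 1 excludes the vertex at distance
  \<open>a\<close>.\<close>

lemma outdeg_bounds:
  assumes v: "v < n"
  shows "int a - 1 \<le> outdeg v" "outdeg v \<le> int b"
    "outdeg v = int b \<Longrightarrow> \<exists>c. long v c" "outdeg v = int a - 1 \<Longrightarrow> \<exists>c. short v c"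
proof -
  let ?D = "\<lambda>k. {c. c < n \<and> 0 < cdist n v c \<and> cdist n v c \<le> k}"
  have D: "card (?D k) = k" if "k \<le> b" for k using card_cdist_heads v that b_less_n by auto
  have sub: "{c. (v, c) \<in> E} \<subseteq> ?D b" using edgeD edge_le v by (auto simp: cdist_pos)
  have sup: "?D (a - 1) \<subseteq> {c. (v, c) \<in> E}"
    using edge_if_close v a_pos by (fastforce simp: cdist_pos)
  have "card (?D (a - 1)) \<le> card {c. (v, c) \<in> E}" using sup finite_nbrs by (intro card_mono)
  then show "int a - 1 \<le> outdeg v" using D[of "a - 1"] a_less_b by (simp add: outdeg_def)
  have "card {c. (v, c) \<in> E} \<le> card (?D b)" using sub by (intro card_mono) auto
  then show "outdeg v \<le> int b" using D[of b] by (simp add: outdeg_def)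
  show "\<exists>c. long v c" if "outdeg v = int b"
  proof (rule ccontr)
    assume no: "\<nexists>c. long v c"
    then have "{c. (v, c) \<in> E} \<subseteq> ?D (b - 1)" using sub by (fastforce simp: long_def)
    then have "card {c. (v, c) \<in> E} \<le> card (?D (b - 1))" by (intro card_mono) auto
    then show False using that D[of "b - 1"] a_less_b by (simp add: outdeg_def)
  qed
  show "\<exists>c. short v c" if "outdeg v = int a - 1"
  proof (rule ccontr)
    assume no: "\<nexists>c. short v c"
    obtain c where c: "c < n" "cdist n v c = a" using ex_head_cdist v a_less_b b_less_n
      by (meson less_trans)
    then have "v \<noteq> c" using a_pos v by (auto simp: cdist_if)
    \<comment> \<open>The reversed pair has length n - a > b.\<close>
    have "(c, v) \<notin> E"
      using edge_le[of c v] cdist_swap[of v n c] c v \<open>v \<noteq> c\<close> a_less_b b_le_half by auto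
    then have E: "(v, c) \<in> E" using no c v \<open>v \<noteq> c\<close> by (auto simp: short_def nonedge_def)
    have "?D a \<subseteq> {c. (v, c) \<in> E}"
    proof
      fix d assume d: "d \<in> ?D a"
      then show "d \<in> {c. (v, c) \<in> E}"
        using E c interval(1)[OF E, of d] cdist_head_inj[of v n c d] v by (cases "cdist n v d = a") auto
    qed
    then have "card (?D a) \<le> card {c. (v, c) \<in> E}" using finite_nbrs by (intro card_mono)
    then show False using that D[of a] a_less_b by (simp add: outdeg_def)
  qed
qed

lemma indeg_bounds:
  assumes v: "v < n"
  shows "int a - 1 \<le> indeg v" "indeg v \<le> int b"
    "indeg v = int b \<Longrightarrow> \<exists>c. long c v" "indeg v = int a - 1 \<Longrightarrow> \<exists>c. short c v"
proof -
  let ?D = "\<lambda>k. {c. c < n \<and> 0 < cdist n c v \<and> cdist n c v \<le> k}"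
  have D: "card (?D k) = k" if "k \<le> b" for k using card_cdist_tails v that b_less_n by auto
  have sub: "{c. (c, v) \<in> E} \<subseteq> ?D b" using edgeD edge_le v by (auto simp: cdist_pos)
  have sup: "?D (a - 1) \<subseteq> {c. (c, v) \<in> E}"
    using edge_if_close v a_pos by (fastforce simp: cdist_pos)
  have "card (?D (a - 1)) \<le> card {c. (c, v) \<in> E}" using sup finite_nbrs by (intro card_mono)
  then show "int a - 1 \<le> indeg v" using D[of "a - 1"] a_less_b by (simp add: indeg_def)
  have "card {c. (c, v) \<in> E} \<le> card (?D b)" using sub by (intro card_mono) auto
  then show "indeg v \<le> int b" using D[of b] by (simp add: indeg_def)
  show "\<exists>c. long c v" if "indeg v = int b"
  proof (rule ccontr)
    assume no: "\<nexists>c. long c v"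
    then have "{c. (c, v) \<in> E} \<subseteq> ?D (b - 1)" using sub by (fastforce simp: long_def)
    then have "card {c. (c, v) \<in> E} \<le> card (?D (b - 1))" by (intro card_mono) auto
    then show False using that D[of "b - 1"] a_less_b by (simp add: indeg_def)
  qed
  show "\<exists>c. short c v" if "indeg v = int a - 1"
  proof (rule ccontr)
    assume no: "\<nexists>c. short c v"
    obtain c where c: "c < n" "cdist n c v = a" using ex_tail_cdist v a_less_b b_less_n
      by (meson less_trans)
    then have "v \<noteq> c" using a_pos v by (auto simp: cdist_if)
    have "(v, c) \<notin> E"
      using edge_le[of v c] cdist_swap[of c n v] c v \<open>v \<noteq> c\<close> a_less_b b_le_half by auto
    then have E: "(c, v) \<in> E" using no c v \<open>v \<noteq> c\<close> by (auto simp: short_def nonedge_def)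
    have "?D a \<subseteq> {c. (c, v) \<in> E}"
    proof
      fix d assume d: "d \<in> ?D a"
      show "d \<in> {c. (c, v) \<in> E}"
      proof (cases "cdist n d v = a")
        case True
        then show ?thesis using E c cdist_tail_inj[of v n c d] v d by auto
      next
        case False
        then have "0 < cdist n c d" "cdist n c d < cdist n c v"
          using d c v by (auto simp: cdist_if split: if_splits)
        then show ?thesis using interval(2)[OF E, of d] d by auto
      qed
    qed
    then have "card (?D a) \<le> card {c. (c, v) \<in> E}" using finite_nbrs by (intro card_mono)
    then show False using that D[of a] a_less_b by (simp add: indeg_def)
  qed
qed

text \<open>Without a common neighbour the degree bounds would make the gain at least a - 1 \<ge> 0,
  against \<open>gain_short\<close>. With one, the equality case of
  \<open>degrees_extremal_le\<close> eliminates \<open>common\<close> from the gain formula.\<close>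

lemma gain_short_eq:
  assumes s: "short w x"
  shows "0 < common x w"
    and "P3_gain n E w x = 3 * int n - 4 * int a - 2 * (outdeg x + indeg w) - 2"
proof -
  have g: "P3_gain n E w x = outdeg x + indeg w - 3 * common x w - (int a - 1)"
    using gain_extremal[OF extremal_short[OF s]] shortD[OF s] by simp
  show pos: "0 < common x w"
  proof (rule ccontr)
    assume "\<not> 0 < common x w"
    then have "common x w = 0" by (simp add: common_def)
    then show False using g gain_short[OF s] outdeg_bounds(1)[of x] indeg_bounds(1)[of w] shortD[OF s] a_pos
      by simp
  qed
  show "P3_gain n E w x = 3 * int n - 4 * int a - 2 * (outdeg x + indeg w) - 2"
    using g degrees_extremal_le(2)[OF extremal_short[OF s] pos] shortD[OF s] by simp
qed

text \<open>Only an inequality, since a long edge may lie in no cyclic triangle.\<close>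

lemma gain_long_le:
  assumes l: "long u v"
  shows "P3_gain n E u v \<le> 3 * int n - 4 * int b - 2 * (outdeg v + indeg u) - 2"
  using gain_extremal[OF extremal_long[OF l]] degrees_extremal_le(1)[OF extremal_long[OF l]] longD[OF l]
  by simp

section \<open>Exchanging pairs that share a vertex\<close>

text \<open>A common neighbour \<open>d\<close> of \<open>(w, x)\<close> exists. As the farthest
  out-neighbour of \<open>x\<close>, the vertex \<open>y\<close> is \<open>d\<close> or lies between
  \<open>d\<close> and \<open>w\<close>, hence is joined to \<open>w\<close>. Inserting
  \<open>(w, x)\<close> therefore lowers the gain of \<open>(x, y)\<close> by 2, which turns the
  strict loss of the exchange into the bound -3.\<close>

lemma short_then_long:
  assumes s: "short w x" and l: "long x y"
  shows "(y, w) \<in> E" "P3_gain n E w x - P3_gain n E x y \<le> -3"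
proof -
  note sd = shortD[OF s] and ld = longD[OF l]
  have "{c. (x, c) \<in> E \<and> (c, w) \<in> E} \<noteq> {}"
    using gain_short_eq(1)[OF s] unfolding common_def by (metis card.empty of_nat_0 less_irrefl)
  then obtain d where d: "(x, d) \<in> E" "(d, w) \<in> E" by auto
  then have dn: "d < n" "d \<noteq> x" "d \<noteq> w" using edgeD by auto
  show yw: "(y, w) \<in> E"
  proof (cases "d = y")
    case False
    have "y \<noteq> w" using sd ld by auto
    have 1: "cdist n x d < cdist n x y"
      using edge_le[OF d(1)] ld cdist_head_inj[of x n d y] dn False by fastforce
    \<comment> \<open>The left side is \<open>b\<close>, the right side is n - a, and a + b <
      n.\<close>
    have "cdist n x y < cdist n x w"
      using ld sd cdist_swap[of w n x] a_less_b b_le_half by auto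
    then have "0 < cdist n d y" "cdist n d y < cdist n d w"
      using 1 dn sd ld cdist_from_inner[of x n d y] cdist_from_inner[of x n d w] by simp_all
    then show ?thesis using interval(2)[OF d(2), of y] ld by auto
  qed (use d in simp)
  have "P3t (E \<union> {(w, x)} - {(x, y)}) < P3t E" using s l by (intro modified_P3t) auto
  moreover have "int (P3t (insert (w, x) E)) = int (P3t E) + P3_gain n E w x"
    using P3t_insert[OF edges_subset] s by (simp add: short_def)
  moreover have "int (P3t (insert (w, x) E - {(x, y)})) =
      int (P3t (insert (w, x) E)) - P3_gain n (insert (w, x) E) x y"
    using edges_subset sd ld yw by (intro P3t_remove) auto
  moreover have "P3_gain n (insert (w, x) E) x y = P3_gain n E x y - 2"
    using sd ld yw edge_asym[OF yw] edgeD[OF yw] by (intro P3_gain_insert_tail) auto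
  ultimately show "P3_gain n E w x - P3_gain n E x y \<le> -3" by simp
qed

lemma long_then_short:
  assumes s: "short w x" and l: "long y w"
  shows "(x, y) \<in> E" "P3_gain n E w x - P3_gain n E y w \<le> -3"
proof -
  note sd = shortD[OF s] and ld = longD[OF l]
  have "{c. (x, c) \<in> E \<and> (c, w) \<in> E} \<noteq> {}"
    using gain_short_eq(1)[OF s] unfolding common_def by (metis card.empty of_nat_0 less_irrefl)
  then obtain d where d: "(x, d) \<in> E" "(d, w) \<in> E" by auto
  then have dn: "d < n" "d \<noteq> x" "d \<noteq> w" using edgeD by auto
  show xy: "(x, y) \<in> E"
  proof (cases "d = y")
    case False
    have "y \<noteq> x" using sd ld by auto
    have 1: "cdist n d w < cdist n y w"
      using edge_le[OF d(2)] ld cdist_tail_inj[of w n d y] dn False by fastforce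
    have "cdist n y w < cdist n x w"
      using ld sd cdist_swap[of w n x] a_less_b b_le_half by auto
    then have "0 < cdist n x y" "cdist n x y < cdist n x d"
      using 1 dn sd ld cdist_to_inner[of x n y w] cdist_to_inner[of x n d w] by simp_all
    then show ?thesis using interval(1)[OF d(1), of y] ld by auto
  qed (use d in simp)
  have "P3t (E \<union> {(w, x)} - {(y, w)}) < P3t E" using s l by (intro modified_P3t) auto
  moreover have "int (P3t (insert (w, x) E)) = int (P3t E) + P3_gain n E w x"
    using P3t_insert[OF edges_subset] s by (simp add: short_def)
  moreover have "int (P3t (insert (w, x) E - {(y, w)})) =
      int (P3t (insert (w, x) E)) - P3_gain n (insert (w, x) E) y w"
    using edges_subset sd ld xy by (intro P3t_remove) auto
  moreover have "P3_gain n (insert (w, x) E) y w = P3_gain n E y w - 2"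
    using sd ld xy edge_asym[OF xy] edgeD[OF xy] by (intro P3_gain_insert_head) auto
  ultimately show "P3_gain n E w x - P3_gain n E y w \<le> -3" by simp
qed

section \<open>Tight bounds and the global exchange\<close>

lemma gain_short_ge:
  assumes s: "short w x" shows "P3_gain n E w x \<ge> 3 * int n - 4 * int a - 4 * int b - 2"
  using gain_short_eq(2)[OF s] outdeg_bounds(2)[of x] indeg_bounds(2)[of w] shortD[OF s] by simp

lemma gain_long_le_uniform:
  assumes l: "long u v" shows "P3_gain n E u v \<le> 3 * int n - 4 * int a - 4 * int b + 2"
  using gain_long_le[OF l] outdeg_bounds(1)[of v] indeg_bounds(1)[of u] longD[OF l] by simp

lemma sum_bounds:
  "3 * int n - 1 \<le> 4 * int a + 4 * int b" "4 * int a + 4 * int b \<le> 3 * int n + 1"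
proof -
  obtain u v where l: "long u v" using ex_edge by (auto simp: long_def)
  obtain w x where s: "short w x" using ex_nonedge by (auto simp: short_def)
  show "3 * int n - 1 \<le> 4 * int a + 4 * int b" using gain_short_ge[OF s] gain_short[OF s] by presburger
  show "4 * int a + 4 * int b \<le> 3 * int n + 1" using gain_long_le_uniform[OF l] gain_long[OF l] by presburger
qed

text \<open>The gain formula and \<open>sum_bounds\<close> leave a total degree deficit of at most
  1. With deficit exactly 1 one of the two degrees is still \<open>b\<close>, which supplies an
  adjacent long edge; the gains then differ by at least -2, against the bound -3.\<close>

lemma short_flanks:
  assumes s: "short w x" shows "outdeg x = int b" "indeg w = int b"
proof -
  note g = gain_short_eq(2)[OF s] gain_short[OF s]
  have ub: "outdeg x \<le> int b" "indeg w \<le> int b"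
    using outdeg_bounds(2) indeg_bounds(2) shortD[OF s] by auto
  have lb: "2 * int b - 1 \<le> outdeg x + indeg w" using g sum_bounds(2) by presburger
  have "outdeg x = int b \<and> indeg w = int b"
  proof (rule ccontr)
    assume "\<not> ?thesis"
    then have sum: "outdeg x + indeg w = 2 * int b - 1" and "outdeg x = int b \<or> indeg w = int b"
      using ub lb by presburger+
    then consider y where "long x y" | y where "long y w"
      using outdeg_bounds(3)[of x] indeg_bounds(3)[of w] shortD[OF s] by blast
    then show False
    proof cases
      case 1
      show False using short_then_long(2)[OF s 1] gain_long_le_uniform[OF 1] g sum by presburger
    next
      case 2
      show False using long_then_short(2)[OF s 2] gain_long_le_uniform[OF 2] g sum by presburger
    qed
  qed
  then show "outdeg x = int b" "indeg w = int b" by auto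
qed

text \<open>Dual to \<open>short_flanks\<close>: the excess over the minimal degrees is at most 1,
  and excess 1 again yields an adjacent exchange with difference at least -2.\<close>

lemma long_flanks:
  assumes l: "long u v" shows "outdeg v = int a - 1" "indeg u = int a - 1"
proof -
  note g = gain_long_le[OF l] gain_long[OF l]
  have lb: "int a - 1 \<le> outdeg v" "int a - 1 \<le> indeg u"
    using outdeg_bounds(1) indeg_bounds(1) longD[OF l] by auto
  have ub: "outdeg v + indeg u \<le> 2 * int a - 1" using g sum_bounds(1) by presburger
  have "outdeg v = int a - 1 \<and> indeg u = int a - 1"
  proof (rule ccontr)
    assume "\<not> ?thesis"
    then have sum: "outdeg v + indeg u = 2 * int a - 1" and "outdeg v = int a - 1 \<or> indeg u = int a - 1"
      using ub lb by presburger+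
    then consider y where "short v y" | y where "short y u"
      using outdeg_bounds(4)[of v] indeg_bounds(4)[of u] longD[OF l] by blast
    then show False
    proof cases
      case 1
      show False using long_then_short(2)[OF 1 l] gain_short_ge[OF 1] g sum by presburger
    next
      case 2
      show False using short_then_long(2)[OF 2 l] gain_short_ge[OF 2] g sum by presburger
    qed
  qed
  then show "outdeg v = int a - 1" "indeg u = int a - 1" by auto
qed

text \<open>Short non-edges and long edges alternate head to tail, so there are equally many of
  each. Every insertion gains at least \<open>k\<close>. A deletion costs at most k + 4 on its own,
  but at most \<open>k\<close> after the insertions, because each long edge meets a short non-edge
  at both ends.\<close>

lemma contradiction: False
proof -
  define X where "X = {(w, x). short w x}"
  define Y where "Y = {(u, v). long u v}"
  define k where "k = 3 * int n - 4 * int a - 4 * int b - 2"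
  have "X \<subseteq> {..<n} \<times> {..<n}" using shortD by (auto simp: X_def)
  then have finX: "finite X" by (rule finite_subset) simp
  have YE: "Y \<subseteq> E" by (auto simp: Y_def long_def)
  then have finY: "finite Y" using finite_E by (rule finite_subset)
  have after_short: "\<exists>y. long x y" if "short w x" for w x
    using short_flanks[OF that] outdeg_bounds(3) shortD[OF that] by blast
  have after_long: "\<exists>z. short v z" if "long u v" for u v
    using long_flanks[OF that] outdeg_bounds(4) longD[OF that] by blast
  have before_long: "\<exists>w. short w u" if "long u v" for u v
    using long_flanks[OF that] indeg_bounds(4) longD[OF that] by blast
  have "v = v'" if "long u v" "long u v'" for u v v'
    using cdist_head_inj[of u n v v'] longD[OF that(1)] longD[OF that(2)] by simp
  moreover have "w = w'" if "short w x" "short w' x" for w w' x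
    using cdist_tail_inj[of x n w w'] shortD[OF that(1)] shortD[OF that(2)] by simp
  ultimately have inj: "inj_on fst Y" "inj_on snd X"
    unfolding inj_on_def X_def Y_def by auto
  have "snd ` X = fst ` Y"
    using after_short before_long by (force simp: X_def Y_def)
  then have card_eq: "card X = card Y" using card_image inj by metis
  have matchX: "{u, v} \<inter> {u', v'} = {}" if "(u, v) \<in> X" "(u', v') \<in> X" "(u, v) \<noteq> (u', v')" for u v u' v'
  proof -
    have s: "short u v" "short u' v'" using that by (auto simp: X_def)
    have "u \<noteq> u'" "v \<noteq> v'"
      using that(3) shortD[OF s(1)] shortD[OF s(2)] cdist_head_inj[of u n v v'] cdist_tail_inj[of v n u u'] by auto
    \<comment> \<open>If two short pairs met head to tail, the common vertex would also be the tail
      of a long edge.\<close>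
    moreover have "v \<noteq> u'" "u \<noteq> v'" using after_short not_short_and_long_tail s by blast+
    ultimately show ?thesis by auto
  qed
  have matchY: "{u, v} \<inter> {u', v'} = {}" if "(u, v) \<in> Y" "(u', v') \<in> Y" "(u, v) \<noteq> (u', v')" for u v u' v'
  proof -
    have s: "long u v" "long u' v'" using that by (auto simp: Y_def)
    have "u \<noteq> u'" "v \<noteq> v'"
      using that(3) longD[OF s(1)] longD[OF s(2)] cdist_head_inj[of u n v v'] cdist_tail_inj[of v n u u'] by auto
    moreover have "v \<noteq> u'" "u \<noteq> v'" using after_long not_short_and_long_tail s by blast+
    ultimately show ?thesis by auto
  qed
  have "int (P3t (E \<union> X)) = int (P3t E) + (\<Sum>(u, v)\<in>X. P3_gain n E u v)"
    by (rule P3t_insert_matching[OF finX edges_subset _ matchX]) (auto simp: X_def short_def)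
  moreover have "(\<Sum>(u, v)\<in>X. P3_gain n E u v) \<ge> (\<Sum>(u, v)\<in>X. k)"
    using gain_short_ge by (intro sum_mono) (auto simp: X_def k_def)
  moreover have "int (P3t (E \<union> X - Y)) = int (P3t (E \<union> X)) - (\<Sum>(u, v)\<in>Y. P3_gain n (E \<union> X) u v)"
  proof (rule P3t_remove_matching[OF finY _ _ matchY])
    show "E \<union> X \<subseteq> {0..<n} \<times> {0..<n}" using edges_subset shortD by (auto simp: X_def)
    show "(u, v) \<in> E \<union> X \<and> (v, u) \<notin> E \<union> X \<and> u \<noteq> v" if "(u, v) \<in> Y" for u v
      using that longD[of u v] shortD[of v u] by (auto simp: X_def Y_def)
  qed
  moreover have "(\<Sum>(u, v)\<in>Y. P3_gain n (E \<union> X) u v) \<le> (\<Sum>(u, v)\<in>Y. k)"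
  proof (rule sum_mono, clarify)
    fix u v assume "(u, v) \<in> Y"
    then have l: "long u v" by (simp add: Y_def)
    obtain w where w: "short w u" using before_long l by blast
    obtain z where z: "short v z" using after_long l by blast
    note ld = longD[OF l] and wd = shortD[OF w] and zd = shortD[OF z]
    have vw: "(v, w) \<in> E" using short_then_long(1)[OF w l] .
    have zu: "(z, u) \<in> E" using long_then_short(1)[OF z l] .
    have ne: "w \<noteq> v" "z \<noteq> u" using edgeD vw zu by auto
    \<comment> \<open>Of all the inserted edges, only \<open>(w, u)\<close> and
      \<open>(v, z)\<close> meet \<open>u\<close> or \<open>v\<close>.\<close>
    have X1: "(c, u) \<in> X \<longleftrightarrow> c = w" for c
      using matchX[of c u w u] w by (auto simp: X_def)
    have X2: "(v, c) \<in> X \<longleftrightarrow> c = z" for c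
      using matchX[of v c v z] z by (auto simp: X_def)
    have X3: "(u, c) \<notin> X" "(c, v) \<notin> X" for c
      using not_short_and_long_tail not_short_and_long_head l by (auto simp: X_def)
    have "P3_gain n (E \<union> X) u v = P3_gain n (insert (w, u) (insert (v, z) E)) u v"
      by (rule P3_gain_cong) (use X1 X2 X3 ne ld in auto)
    also have "\<dots> = P3_gain n (insert (v, z) E) u v - 2"
      using ld wd zd vw edge_asym[OF vw] ne by (intro P3_gain_insert_tail) auto
    also have "P3_gain n (insert (v, z) E) u v = P3_gain n E u v - 2"
      using ld zd zu edge_asym[OF zu] ne by (intro P3_gain_insert_head) auto
    finally show "P3_gain n (E \<union> X) u v \<le> k"
      using gain_long_le_uniform[OF l] by (simp add: k_def)
  qed
  ultimately have "int (P3t E) \<le> int (P3t (E \<union> X - Y))"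
    using card_eq by (simp add: case_prod_unfold)
  moreover have "P3t (E \<union> X - Y) < P3t E"
  proof (rule modified_P3t)
    show "X \<union> Y \<noteq> {}" using ex_edge by (auto simp: Y_def long_def)
  qed (simp_all add: X_def Y_def)
  ultimately show False by simp
qed

end

section \<open>Passage from optimality to the two inequalities\<close>

theorem mainTheorem14:
  fixes n :: nat and E :: "(nat \<times> nat) set"
  assumes "n \<ge> 4" and "optimal n E"
  shows "enat (beta n E) \<le> alpha n E \<and>
         (alpha n E = enat (beta n E) \<or> alpha n E = enat (beta n E + 1))"
proof -
  have opt: "two_free E" "circ_interval n E"
    "\<And>F. two_free F \<Longrightarrow> circ_interval n F \<Longrightarrow> P3t F \<le> P3t E"
    "\<And>F. two_free F \<Longrightarrow> circ_interval n F \<Longrightarrow> P3t F = P3t E \<Longrightarrow> xi n E \<le> xi n F"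
    using assms(2) unfolding optimal_def by blast+
  interpret interval_digraph n E using opt by unfold_locales
  \<comment> \<open>An induced path supplies both an edge and a non-edge, so \<open>alpha\<close>
    and \<open>beta\<close> are not the default values \<infinity> and 0. It exists because the
    digraph \<open>?F\<close> below has one and the path count of \<open>E\<close> is
    maximal.\<close>
  have "\<exists>p q r. (p, q) \<in> E \<and> (q, r) \<in> E \<and> p \<noteq> r \<and> (p, r) \<notin> E \<and> (r, p) \<notin> E"
  proof (rule ccontr)
    assume "\<not> ?thesis"
    then have "P3t E = 0" unfolding P3t_def by (intro card_eq_0_iff[THEN iffD2] disjI1) blast
    let ?F = "{(0, 1), (1, 2)} :: (nat \<times> nat) set"
    have "two_free ?F" by (auto simp: two_free_def)
    moreover have "circ_interval n ?F"
      using assms(1) by (auto simp: circ_interval_def digraph_def clockwise_def cdist_if split: if_splits)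
    ultimately have "P3t ?F = 0" using opt(3) \<open>P3t E = 0\<close> by fastforce
    moreover have "{(a, b, c). a \<noteq> b \<and> b \<noteq> c \<and> a \<noteq> c \<and> (a, b) \<in> ?F \<and> (b, c) \<in> ?F
        \<and> (a, c) \<notin> ?F \<and> (c, a) \<notin> ?F} = {(0, 1, 2)}" by auto
    ultimately show False by (simp only: P3t_def) simp
  qed
  then obtain p q r where pqr: "(p, q) \<in> E" "nonedge n E p r"
    using edgeD unfolding nonedge_def by metis
  define a where "a = Min {cdist n u v | u v. nonedge n E u v}"
  define b where "b = Max {cdist n u v | u v. (u, v) \<in> E}"
  have alpha: "alpha n E = enat a" and beta: "beta n E = b"
    using pqr by (auto simp: alpha_def beta_def a_def b_def)
  let ?A = "{cdist n u v | u v. nonedge n E u v}" and ?B = "{cdist n u v | u v. (u, v) \<in> E}"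
  have "?A \<subseteq> {..<n}" "?B \<subseteq> {..<n}" using cdist_less edgeD by (auto simp: nonedge_def)
  then have fin: "finite ?A" "finite ?B" using finite_subset by blast+
  have ne: "?A \<noteq> {}" "?B \<noteq> {}" using pqr by blast+
  have a_le: "a \<le> cdist n u v" if "nonedge n E u v" for u v
    unfolding a_def by (rule Min_le[OF fin(1)]) (use that in blast)
  have b_ge: "cdist n u v \<le> b" if "(u, v) \<in> E" for u v
    unfolding b_def by (rule Max_ge[OF fin(2)]) (use that in blast)
  obtain w x where wx: "nonedge n E w x" "cdist n w x = a"
    using Min_in[OF fin(1) ne(1)] unfolding a_def by auto
  obtain u v where uv: "(u, v) \<in> E" "cdist n u v = b"
    using Max_in[OF fin(2) ne(2)] unfolding b_def by auto
  have "b \<le> a"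
  proof (rule ccontr)
    assume "\<not> b \<le> a"
    then interpret unbalanced n E a b
      using opt a_le b_ge wx uv by unfold_locales auto
    show False by (rule contradiction)
  qed
  moreover have "a \<le> b + 1"
  proof (rule ccontr)
    assume far: "\<not> a \<le> b + 1"
    have half: "2 * b \<le> n" using longest_le_half[OF opt(3) uv b_ge] .
    have wx': "w < n" "x < n" "w \<noteq> x" "nonedge n E x w" using wx by (auto simp: nonedge_def)
    \<comment> \<open>The reversed non-edge has length n - a, which is again at least
      \<open>a\<close>.\<close>
    have "2 * a \<le> n" using a_le[OF wx'(4)] cdist_swap[of w n x] wx wx' by linarith
    \<comment> \<open>The pair \<open>(u, c)\<close> is too long to be an edge, and so is its
      reverse, of length n - b - 1 > b. It is thus a non-edge of length b + 1 < a.\<close>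
    then obtain c where c: "c < n" "cdist n u c = b + 1"
      using ex_head_cdist[of u n "b + 1"] edgeD[OF uv(1)] far by auto
    then have "u \<noteq> c" by (auto simp: cdist_if)
    have "cdist n c u = n - (b + 1)" using cdist_swap[of u n c] c \<open>u \<noteq> c\<close> edgeD[OF uv(1)] by simp
    then have "(u, c) \<notin> E" "(c, u) \<notin> E"
      using b_ge[of u c] b_ge[of c u] c \<open>2 * a \<le> n\<close> far by auto
    then have "nonedge n E u c" using c \<open>u \<noteq> c\<close> edgeD[OF uv(1)] by (simp add: nonedge_def)
    then show False using a_le[of u c] c far by simp
  qed
  ultimately show ?thesis unfolding alpha beta by auto
qed

end
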